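(* Let $E$ be a Picard-Vessiot extension of $F$ with differential Galois group $\mathrm{SL}_3(C)$ and defining matrix $A=\sum_{i=1}^3(a_* )^-_iX_{-\alpha_i}+\sum_{i=1}^2(a_* )^0_iH_i+\sum_{i=1}^3(a_* )^+_iX_{\alpha_i}\in\mathfrak{sl}_3(F)$, and let $r_1,r_2$ be differential indeterminates over $E$. Let $c_2,c_1,c_0\in E\{r_1,r_2\}$ be $$c_2=-(a_* )^+_3,\qquad c_1=(a_* )^+_3r_1r_2-r_2(a_* )^+_2-r_1(a_* )^+_1+(a_* )^0_1+(a_* )^0_2,$$ $$c_0=r_2(a_* )^-_1+(a_* )^-_3-\big(r_2((a_* )^0_2-(a_* )^0_1)+(a_* )^-_2\big)r_1+\big(r_2(a_* )^+_2-(a_* )^0_2\big)r_1r_2-r_1r_2'.$$ Then for every integer $m>0$ the system of $m$ differential equations $$y_k'=\big(c_2y_{m-1}-mc_1+kc_1\big)y_k+(k-m-1)c_2\,y_{k-1}+(k+1)c_0\,y_{k+1},\qquad k=0,\dots,m-1,$$ with the convention $y_m=1$, $y_{-1}=0$, has no solution $(y_0,\dots,y_{m-1})\in E\langle r_1,r_2\rangle^m$.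
   Context: $F$ is a differential field of characteristic zero with algebraically closed field of constants $C$; $E\{\cdot\}$, $E\langle\cdot\rangle$ denote the generated differential ring and field over $E$. For $\mathrm{SL}_3$, $\alpha_1,\alpha_2$ are the simple roots, $\alpha_3=\alpha_1+\alpha_2$, and $\{H_i,X_{\pm\alpha_j}\}$ is the standard Chevalley basis of $\mathfrak{sl}_3$: $X_{\alpha_1}=E_{12}$, $X_{\alpha_2}=E_{23}$, $X_{\alpha_3}=E_{13}$, $X_{-\alpha_j}=X_{\alpha_j}^{tr}$, $H_1=\mathrm{diag}(1,-1,0)$, $H_2=\mathrm{diag}(0,1,-1)$. The elements $c_0,c_1,c_2$ are the coefficients of the differential polynomial $b'+c_2b^2+c_1b+c_0$ in a differential indeterminate $b$, which is the coefficient of $X_{-\alpha_3}$ after gauge transforming $A$ first by $u_{-\alpha_1}(r_1)u_{-\alpha_2}(r_2)$ and then by $u_{-\alpha_3}(b)$, where $u_\alpha(x)=\exp(xX_\alpha)$ and $g.A=gAg^{-1}+g'g^{-1}$. *)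

theory Defs
  imports
    "HOL-Analysis.Determinants"
    "HOL-Computational_Algebra.Polynomial"
    "HOL-Library.FuncSet"
    "HOL-Library.Poly_Mapping"
begin

text \<open>
  All fields live inside one ambient differential field, given by a field type and a
  derivation \<^term>\<open>D\<close> on it; differential subfields are sets of that type.
\<close>

definition derivation :: "('a::field \<Rightarrow> 'a) \<Rightarrow> bool" where
  "derivation D \<longleftrightarrow>
     (\<forall>x y. D (x + y) = D x + D y) \<and> (\<forall>x y. D (x * y) = D x * y + x * D y)"

definition subfield_set :: "'a::field set \<Rightarrow> bool" where
  "subfield_set K \<longleftrightarrow>
     0 \<in> K \<and> 1 \<in> K \<and>
     (\<forall>x\<in>K. \<forall>y\<in>K. x + y \<in> K \<and> x * y \<in> K) \<and>
     (\<forall>x\<in>K. - x \<in> K \<and> inverse x \<in> K)"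

definition diff_subfield :: "('a::field \<Rightarrow> 'a) \<Rightarrow> 'a set \<Rightarrow> bool" where
  "diff_subfield D K \<longleftrightarrow> subfield_set K \<and> (\<forall>x\<in>K. D x \<in> K)"

definition constants :: "('a::field \<Rightarrow> 'a) \<Rightarrow> 'a set \<Rightarrow> 'a set" where
  "constants D K = {x \<in> K. D x = 0}"

definition algebraically_closed_set :: "'a::field set \<Rightarrow> bool" where
  "algebraically_closed_set K \<longleftrightarrow>
     (\<forall>p. (\<forall>i. coeff p i \<in> K) \<and> degree p > 0 \<longrightarrow> (\<exists>x\<in>K. poly p x = 0))"

definition diff_field_gen :: "('a::field \<Rightarrow> 'a) \<Rightarrow> 'a set \<Rightarrow> 'a set" where
  "diff_field_gen D S = \<Inter>{K. diff_subfield D K \<and> S \<subseteq> K}"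

text \<open>
  A polynomial in variables of type \<^typ>\<open>'v\<close> is a finitely supported map from monomials
  (finitely supported exponent vectors) to coefficients.
\<close>

definition mpoly_eval :: "(('v \<Rightarrow>\<^sub>0 nat) \<Rightarrow>\<^sub>0 'a::comm_ring_1) \<Rightarrow> ('v \<Rightarrow> 'a) \<Rightarrow> 'a" where
  "mpoly_eval p x =
     (\<Sum>m\<in>Poly_Mapping.keys p.
        Poly_Mapping.lookup p m *
        (\<Prod>v\<in>Poly_Mapping.keys m. x v ^ Poly_Mapping.lookup m v))"

definition alg_independent :: "'a::field set \<Rightarrow> ('v \<Rightarrow> 'a) \<Rightarrow> bool" where
  "alg_independent K x \<longleftrightarrow>
     (\<forall>p. range (Poly_Mapping.lookup p) \<subseteq> K \<and> mpoly_eval p x = 0 \<longrightarrow> p = 0)"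

definition diff_indeterminates ::
    "('a::field \<Rightarrow> 'a) \<Rightarrow> 'a set \<Rightarrow> ('i \<Rightarrow> 'a) \<Rightarrow> bool" where
  "diff_indeterminates D K r \<longleftrightarrow> alg_independent K (\<lambda>(i, k). (D ^^ k) (r i))"

definition matrix_entries :: "'a ^ 'n ^ 'm \<Rightarrow> 'a set" where
  "matrix_entries M = {M $ i $ j | i j. True}"

text \<open>
  Convention: the equation with matrix \<open>A\<close> is \<open>Y' = A Y\<close>, in accordance with the gauge action
  \<open>g.A = g A g\<^sup>-\<^sup>1 + g' g\<^sup>-\<^sup>1\<close> (then \<open>g Y\<close> is a fundamental matrix for \<open>g.A\<close>).
\<close>

definition fundamental_matrix ::
    "('a::field \<Rightarrow> 'a) \<Rightarrow> 'a set \<Rightarrow> 'a ^ 'n ^ 'n \<Rightarrow> 'a ^ 'n ^ 'n \<Rightarrow> bool" where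
  "fundamental_matrix D E A Y \<longleftrightarrow>
     matrix_entries Y \<subseteq> E \<and> invertible Y \<and> map_matrix D Y = A ** Y"

definition picard_vessiot ::
    "('a::field \<Rightarrow> 'a) \<Rightarrow> 'a set \<Rightarrow> 'a set \<Rightarrow> 'a ^ 'n ^ 'n \<Rightarrow> bool" where
  "picard_vessiot D F E A \<longleftrightarrow>
     diff_subfield D F \<and> diff_subfield D E \<and> F \<subseteq> E \<and>
     matrix_entries A \<subseteq> F \<and>
     constants D E = constants D F \<and>
     (\<exists>Y. fundamental_matrix D E A Y \<and> E = diff_field_gen D (F \<union> matrix_entries Y))"

definition diff_galois_group :: "('a::field \<Rightarrow> 'a) \<Rightarrow> 'a set \<Rightarrow> 'a set \<Rightarrow> ('a \<Rightarrow> 'a) set" where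
  "diff_galois_group D F E =
     {\<sigma> \<in> extensional E. bij_betw \<sigma> E E \<and>
        (\<forall>x\<in>E. \<forall>y\<in>E. \<sigma> (x + y) = \<sigma> x + \<sigma> y \<and> \<sigma> (x * y) = \<sigma> x * \<sigma> y) \<and>
        (\<forall>x\<in>E. \<sigma> (D x) = D (\<sigma> x)) \<and>
        (\<forall>x\<in>F. \<sigma> x = x)}"

text \<open>
  The image of the faithful representation of the differential Galois group that sends
  \<open>\<sigma>\<close> to \<open>Y\<^sup>-\<^sup>1 \<sigma>(Y)\<close>. It identifies the Galois group with a matrix group over the constants.
\<close>

definition galois_matrix_group ::
    "('a::field \<Rightarrow> 'a) \<Rightarrow> 'a set \<Rightarrow> 'a set \<Rightarrow> 'a ^ 'n ^ 'n \<Rightarrow> ('a ^ 'n ^ 'n) set" where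
  "galois_matrix_group D F E Y =
     {M. \<exists>\<sigma>\<in>diff_galois_group D F E. map_matrix \<sigma> Y = Y ** M}"

definition SL3 :: "'a::field set \<Rightarrow> ('a ^ 3 ^ 3) set" where
  "SL3 K = {M. matrix_entries M \<subseteq> K \<and> det M = 1}"

definition sl3 :: "'a::field set \<Rightarrow> ('a ^ 3 ^ 3) set" where
  "sl3 K = {M. matrix_entries M \<subseteq> K \<and> trace M = 0}"

definition unit_matrix :: "3 \<Rightarrow> 3 \<Rightarrow> 'a::field ^ 3 ^ 3" where
  "unit_matrix i j = (\<chi> k l. if k = i \<and> l = j then 1 else 0)"

definition scale_matrix :: "'a::field \<Rightarrow> 'a ^ 'n ^ 'm \<Rightarrow> 'a ^ 'n ^ 'm" where
  "scale_matrix c M = map_matrix ((*) c) M"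

text \<open>
  \<open>X_pos i\<close> and \<open>X_neg i\<close> are the root vectors of \<open>\<alpha>\<^sub>i\<close> and \<open>-\<alpha>\<^sub>i\<close>, with \<open>\<alpha>\<^sub>3 = \<alpha>\<^sub>1 + \<alpha>\<^sub>2\<close>.
\<close>

definition X_pos :: "3 \<Rightarrow> 'a::field ^ 3 ^ 3" where
  "X_pos i = (if i = 1 then unit_matrix 1 2
              else if i = 2 then unit_matrix 2 3
              else unit_matrix 1 3)"

definition X_neg :: "3 \<Rightarrow> 'a::field ^ 3 ^ 3" where
  "X_neg i = transpose (X_pos i)"

definition H_diag :: "2 \<Rightarrow> 'a::field ^ 3 ^ 3" where
  "H_diag i = (if i = 1 then unit_matrix 1 1 - unit_matrix 2 2
               else unit_matrix 2 2 - unit_matrix 3 3)"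

definition chevalley_matrix :: "'a::field ^ 3 \<Rightarrow> 'a ^ 2 \<Rightarrow> 'a ^ 3 \<Rightarrow> 'a ^ 3 ^ 3" where
  "chevalley_matrix am a0 ap =
     (\<Sum>i\<in>UNIV. scale_matrix (am $ i) (X_neg i)) +
     (\<Sum>i\<in>UNIV. scale_matrix (a0 $ i) (H_diag i)) +
     (\<Sum>i\<in>UNIV. scale_matrix (ap $ i) (X_pos i))"

end

theory Submission
  imports Defs
begin

text \<open>
  Put \<open>P(b) = \<Sum>k\<le>m. y\<^sub>k b\<^sup>k\<close> and differentiate it along the Riccati equation
  \<open>b' = - (c\<^sub>2 b\<^sup>2 + c\<^sub>1 b + c\<^sub>0)\<close>. Comparing powers of \<open>b\<close>, the system for the \<open>y\<^sub>k\<close> says exactly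
  that the monic polynomial \<open>P\<close> divides its own derivative, with cofactor
  \<open>- m c\<^sub>2 b + c\<^sub>2 y\<^sub>m\<^sub>-\<^sub>1 - m c\<^sub>1\<close>. So the claim is that this Riccati equation has no Darboux polynomial
  of positive degree over \<open>E\<langle>r\<^sub>1, r\<^sub>2\<rangle>\<close>. The argument counts orders of derivatives of \<open>r\<^sub>1\<close> and \<open>r\<^sub>2\<close>.

  No \<open>y\<^sub>k\<close> involves \<open>r\<^sub>1\<close>. Suppose \<open>r\<^sub>1\<^sup>(\<^sup>n\<^sup>)\<close> is the highest derivative of \<open>r\<^sub>1\<close> that occurs in the
  \<open>y\<^sub>k\<close>. Since \<open>c\<^sub>0, c\<^sub>1, c\<^sub>2\<close> contain \<open>r\<^sub>1\<close> but none of its derivatives, the right-hand sides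
  lie in the field \<open>K(r\<^sub>1\<^sup>(\<^sup>n\<^sup>))\<close>, where \<open>K\<close> is generated by \<open>E\<close>, all derivatives of \<open>r\<^sub>2\<close> and the
  lower derivatives of \<open>r\<^sub>1\<close>. But \<open>y\<^sub>k'\<close> is linear in \<open>r\<^sub>1\<^sup>(\<^sup>n\<^sup>+\<^sup>1\<^sup>)\<close>, with coefficient the partial
  derivative of \<open>y\<^sub>k\<close> with respect to \<open>r\<^sub>1\<^sup>(\<^sup>n\<^sup>)\<close>. That partial derivative vanishes, so by
  characteristic zero \<open>y\<^sub>k \<in> K\<close>. Lemma \<open>derivation_drops_transcendental\<close> is this step, and
  \<open>diff_indeterminate_absent\<close> is the descent on \<open>n\<close>.

  Now write \<open>c\<^sub>1 = c\<^sub>1\<^sub>0 + c\<^sub>1\<^sub>1 r\<^sub>1\<close> and \<open>c\<^sub>0 = c\<^sub>0\<^sub>0 + c\<^sub>0\<^sub>1 r\<^sub>1\<close>, where \<open>c\<^sub>0\<^sub>1\<close> is an element of \<open>E(r\<^sub>2)\<close>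
  minus \<open>r\<^sub>2'\<close>, and \<open>c\<^sub>2, c\<^sub>1\<^sub>0, c\<^sub>1\<^sub>1, c\<^sub>0\<^sub>0\<close> lie in \<open>E(r\<^sub>2)\<close>. The terms linear in \<open>r\<^sub>1\<close> give
  \<open>(m - k) c\<^sub>1\<^sub>1 y\<^sub>k = (k + 1) c\<^sub>0\<^sub>1 y\<^sub>k\<^sub>+\<^sub>1\<close>. As \<open>c\<^sub>0\<^sub>1\<close> is nonzero, so is \<open>c\<^sub>1\<^sub>1\<close>, and \<open>P = (b + w)\<^sup>m\<close> with
  \<open>w = c\<^sub>0\<^sub>1 / c\<^sub>1\<^sub>1\<close>. The terms free of \<open>r\<^sub>1\<close> then turn into \<open>w' = c\<^sub>2 w\<^sup>2 - c\<^sub>1\<^sub>0 w + c\<^sub>0\<^sub>0\<close>. Here the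
  right-hand side has order one in \<open>r\<^sub>2\<close>, whereas \<open>w'\<close> contains \<open>- r\<^sub>2'' / c\<^sub>1\<^sub>1\<close>, a contradiction
  (lemma \<open>riccati_no_darboux_polynomial\<close>).
\<close>

section \<open>Subrings, subfields and polynomials over them\<close>

definition subring_set :: "'a::comm_ring_1 set \<Rightarrow> bool" where
  "subring_set R \<longleftrightarrow>
     0 \<in> R \<and> 1 \<in> R \<and> (\<forall>x\<in>R. \<forall>y\<in>R. x + y \<in> R \<and> x * y \<in> R) \<and> (\<forall>x\<in>R. - x \<in> R)"

lemma subfield_set_imp_subring_set: "subfield_set K \<Longrightarrow> subring_set K"
  by (simp add: subfield_set_def subring_set_def)

lemma subring_set_closed:
  assumes "subring_set R"
  shows "0 \<in> R" "1 \<in> R"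
    and "x \<in> R \<Longrightarrow> y \<in> R \<Longrightarrow> x + y \<in> R"
    and "x \<in> R \<Longrightarrow> y \<in> R \<Longrightarrow> x * y \<in> R"
    and "x \<in> R \<Longrightarrow> - x \<in> R"
    and "x \<in> R \<Longrightarrow> y \<in> R \<Longrightarrow> x - y \<in> R"
proof -
  show "x - y \<in> R" if "x \<in> R" "y \<in> R"
    using assms that unfolding subring_set_def by (metis add_uminus_conv_diff)
qed (use assms in \<open>auto simp: subring_set_def\<close>)

lemma subring_set_sum:
  assumes "subring_set R" "\<And>i. i \<in> I \<Longrightarrow> f i \<in> R"
  shows "sum f I \<in> R"
  using assms(2)
  by (induction I rule: infinite_finite_induct) (auto intro: subring_set_closed[OF assms(1)])

lemma subring_set_power: "subring_set R \<Longrightarrow> x \<in> R \<Longrightarrow> x ^ n \<in> R"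
  by (induction n) (auto intro: subring_set_closed)

lemma subring_set_of_nat: "subring_set R \<Longrightarrow> of_nat n \<in> R"
  by (induction n) (auto intro: subring_set_closed)

lemma subring_set_of_int: "subring_set R \<Longrightarrow> of_int n \<in> R"
  by (cases n) (auto intro: subring_set_closed subring_set_of_nat simp del: of_nat_Suc)

lemma subfield_set_closed:
  assumes "subfield_set K"
  shows "0 \<in> K" "1 \<in> K"
    and "x \<in> K \<Longrightarrow> y \<in> K \<Longrightarrow> x + y \<in> K"
    and "x \<in> K \<Longrightarrow> y \<in> K \<Longrightarrow> x * y \<in> K"
    and "x \<in> K \<Longrightarrow> - x \<in> K"
    and "x \<in> K \<Longrightarrow> y \<in> K \<Longrightarrow> x - y \<in> K"
    and "x \<in> K \<Longrightarrow> inverse x \<in> K"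
    and "x \<in> K \<Longrightarrow> y \<in> K \<Longrightarrow> x / y \<in> K"
    and "x \<in> K \<Longrightarrow> x ^ n \<in> K"
    and "of_int k \<in> K"
  using subring_set_closed[OF subfield_set_imp_subring_set[OF assms]]
    subring_set_power[OF subfield_set_imp_subring_set[OF assms]]
    subring_set_of_int[OF subfield_set_imp_subring_set[OF assms]] assms
  by (auto simp: subfield_set_def divide_inverse)

lemma subfield_set_fractions:
  fixes R :: "'a::field set"
  assumes R: "subring_set R"
  shows "subfield_set {a / b | a b. a \<in> R \<and> b \<in> R}" (is "subfield_set ?Q")
proof -
  note cl = subring_set_closed[OF R]
  have fracI: "z \<in> ?Q" if "a \<in> R" "b \<in> R" "z = a / b" for z a b
    using that by blast
  \<comment> \<open>Since \<open>x / 0 = 0\<close>, fractions with denominator zero do no harm, but need their own cases here.\<close>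
  have add: "a / b + c / d \<in> ?Q" if "a \<in> R" "b \<in> R" "c \<in> R" "d \<in> R" for a b c d
  proof -
    consider "b = 0" | "d = 0" | "b \<noteq> 0" "d \<noteq> 0" by blast
    then show ?thesis
    proof cases
      case 1
      then show ?thesis using that by (intro fracI[of c d]) auto
    next
      case 2
      then show ?thesis using that by (intro fracI[of a b]) auto
    next
      case 3
      then show ?thesis using that
        by (intro fracI[of "a * d + c * b" "b * d"] cl) (auto simp: add_frac_eq)
    qed
  qed
  have mult: "a / b * (c / d) \<in> ?Q" if "a \<in> R" "b \<in> R" "c \<in> R" "d \<in> R" for a b c d
    using that by (intro fracI[of "a * c" "b * d"] cl) auto
  have neg: "- (a / b) \<in> ?Q" if "a \<in> R" "b \<in> R" for a b
    using that by (intro fracI[of "- a" b] cl) auto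
  have inv: "inverse (a / b) \<in> ?Q" if "a \<in> R" "b \<in> R" for a b
    using that by (intro fracI[of b a]) auto
  have zero_one: "0 \<in> ?Q" "1 \<in> ?Q"
    using fracI[of 0 1 0] fracI[of 1 1 1] cl(1,2) by simp_all
  have add': "x + y \<in> ?Q" if x: "x \<in> ?Q" and y: "y \<in> ?Q" for x y
  proof -
    obtain a b where "x = a / b" "a \<in> R" "b \<in> R" using x by blast
    moreover obtain c d where "y = c / d" "c \<in> R" "d \<in> R" using y by blast
    ultimately show ?thesis using add by simp
  qed
  have mult': "x * y \<in> ?Q" if x: "x \<in> ?Q" and y: "y \<in> ?Q" for x y
  proof -
    obtain a b where "x = a / b" "a \<in> R" "b \<in> R" using x by blast
    moreover obtain c d where "y = c / d" "c \<in> R" "d \<in> R" using y by blast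
    ultimately show ?thesis using mult by simp
  qed
  have "- x \<in> ?Q \<and> inverse x \<in> ?Q" if x: "x \<in> ?Q" for x
  proof -
    obtain a b where "x = a / b" "a \<in> R" "b \<in> R" using x by blast
    then show ?thesis using neg inv by simp
  qed
  then show ?thesis
    unfolding subfield_set_def using zero_one add' mult' by (intro conjI ballI) simp_all
qed

lemma subset_fractions:
  fixes R :: "'a::field set"
  assumes "1 \<in> R" "S \<subseteq> R"
  shows "S \<subseteq> {a / b | a b. a \<in> R \<and> b \<in> R}"
proof
  fix a assume "a \<in> S"
  then have "a = a / 1 \<and> a \<in> R \<and> 1 \<in> R" using assms by auto
  then show "a \<in> {a / b | a b. a \<in> R \<and> b \<in> R}" by blast
qed

definition subfield_gen :: "'a::field set \<Rightarrow> 'a set" where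
  "subfield_gen S = \<Inter>{K. subfield_set K \<and> S \<subseteq> K}"

lemma subfield_set_subfield_gen: "subfield_set (subfield_gen S)"
  unfolding subfield_gen_def subfield_set_def by auto

lemma subfield_gen_superset: "S \<subseteq> subfield_gen S"
  unfolding subfield_gen_def by auto

lemma subfield_gen_least: "subfield_set K \<Longrightarrow> S \<subseteq> K \<Longrightarrow> subfield_gen S \<subseteq> K"
  unfolding subfield_gen_def by auto

lemma subfield_gen_mono: "S \<subseteq> T \<Longrightarrow> subfield_gen S \<subseteq> subfield_gen T"
  unfolding subfield_gen_def by auto

definition polys_over :: "'a::comm_ring_1 set \<Rightarrow> 'a poly set" where
  "polys_over R = {p. \<forall>i. coeff p i \<in> R}"

lemma subring_set_polys_over:
  assumes "subring_set R"
  shows "subring_set (polys_over R)"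
  unfolding subring_set_def polys_over_def
  by (auto simp: coeff_mult coeff_1 intro!: subring_set_sum[OF assms] subring_set_closed[OF assms])

lemma pderiv_polys_over: "subring_set R \<Longrightarrow> p \<in> polys_over R \<Longrightarrow> pderiv p \<in> polys_over R"
  unfolding polys_over_def
  by (auto simp: coeff_pderiv simp del: of_nat_Suc intro!: subring_set_closed(4) subring_set_of_nat)

lemma poly_in_subring_set:
  "subring_set R \<Longrightarrow> p \<in> polys_over R \<Longrightarrow> t \<in> R \<Longrightarrow> poly p t \<in> R"
  unfolding polys_over_def poly_altdef
  by (auto intro!: subring_set_sum subring_set_closed(4) subring_set_power)

lemma pCons_polys_over:
  "0 \<in> R \<Longrightarrow> a \<in> R \<Longrightarrow> p \<in> polys_over R \<Longrightarrow> pCons a p \<in> polys_over R"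
  unfolding polys_over_def by (auto simp: coeff_pCons split: nat.splits)

lemma subfield_gen_insert_fraction:
  assumes K: "subfield_set K" and y: "y \<in> subfield_gen (insert t K)"
  obtains p q where "p \<in> polys_over K" "q \<in> polys_over K" "y = poly p t / poly q t"
proof -
  note K' = subfield_set_imp_subring_set[OF K]
  note cl = subring_set_closed[OF K'] subring_set_closed[OF subring_set_polys_over[OF K']]
  let ?R = "(\<lambda>p. poly p t) ` polys_over K"
  have evalI: "z \<in> ?R" if "p \<in> polys_over K" "z = poly p t" for z p
    using that by blast
  have "x + y \<in> ?R \<and> x * y \<in> ?R" if x: "x \<in> ?R" and y: "y \<in> ?R" for x y
  proof -
    obtain p where p: "p \<in> polys_over K" "x = poly p t" using x by blast
    obtain q where q: "q \<in> polys_over K" "y = poly q t" using y by blast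
    show ?thesis
      using evalI[of "p + q" "x + y"] evalI[of "p * q" "x * y"] cl p q by simp
  qed
  moreover have "- x \<in> ?R" if x: "x \<in> ?R" for x
  proof -
    obtain p where p: "p \<in> polys_over K" "x = poly p t" using x by blast
    show ?thesis using evalI[of "- p" "- x"] cl p by simp
  qed
  moreover have "0 \<in> ?R" "1 \<in> ?R"
    using evalI[of 0 0] evalI[of 1 1] cl by simp_all
  ultimately have "subring_set ?R"
    unfolding subring_set_def by (intro conjI ballI) simp_all
  then have field: "subfield_set {a / b | a b. a \<in> ?R \<and> b \<in> ?R}"
    by (rule subfield_set_fractions)
  have one: "1 \<in> ?R" using evalI[of 1 1] cl by simp
  have "a \<in> ?R" if "a \<in> insert t K" for a
  proof (cases "a = t")
    case True
    then show ?thesis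
      by (intro evalI[of "[:0, 1:]"]) (auto intro!: pCons_polys_over cl)
  next
    case False
    then show ?thesis using that
      by (intro evalI[of "[:a:]"]) (auto intro!: pCons_polys_over cl)
  qed
  then have "insert t K \<subseteq> {a / b | a b. a \<in> ?R \<and> b \<in> ?R}"
    by (intro subset_fractions[OF one] subsetI)
  from subfield_gen_least[OF field this] y
  obtain a b where "y = a / b" "a \<in> ?R" "b \<in> ?R" by blast
  then show thesis using that by blast
qed

section \<open>Algebraic independence\<close>

definition monomial_value :: "('v \<Rightarrow> 'a::comm_ring_1) \<Rightarrow> ('v \<Rightarrow>\<^sub>0 nat) \<Rightarrow> 'a" where
  "monomial_value x m = (\<Prod>v\<in>Poly_Mapping.keys m. x v ^ Poly_Mapping.lookup m v)"

lemma monomial_value_eq_prod: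
  assumes "finite V" "Poly_Mapping.keys m \<subseteq> V"
  shows "monomial_value x m = (\<Prod>v\<in>V. x v ^ Poly_Mapping.lookup m v)"
  unfolding monomial_value_def using assms
  by (intro prod.mono_neutral_left) (auto simp: in_keys_iff)

lemma monomial_value_add:
  "monomial_value x (m + n) = monomial_value x m * monomial_value x n"
proof -
  let ?V = "Poly_Mapping.keys m \<union> Poly_Mapping.keys n"
  have "Poly_Mapping.keys (m + n) \<subseteq> ?V" by (rule Poly_Mapping.keys_add)
  then show ?thesis
    by (simp add: monomial_value_eq_prod[of ?V] lookup_add power_add prod.distrib)
qed

lemma monomial_value_zero: "monomial_value x 0 = 1"
  by (simp add: monomial_value_def)

lemma monomial_value_single: "monomial_value x (Poly_Mapping.single v n) = x v ^ n"
  by (subst monomial_value_eq_prod[of "{v}"]) auto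

text \<open>
  Algebraic independence in the form in which it is used below: linear independence of the
  monomials over \<open>K\<close>, which spares arithmetic with polynomials in several variables.
\<close>

lemma alg_independent_monomials:
  assumes ind: "alg_independent K x" and "0 \<in> K" and "finite M"
    and c: "\<And>m. m \<in> M \<Longrightarrow> c m \<in> K"
    and sum: "(\<Sum>m\<in>M. c m * monomial_value x m) = 0" and "m \<in> M"
  shows "c m = 0"
proof -
  define p where "p = Abs_poly_mapping (\<lambda>m. if m \<in> M then c m else 0)"
  have lookup: "Poly_Mapping.lookup p = (\<lambda>m. if m \<in> M then c m else 0)"
    unfolding p_def using \<open>finite M\<close>
    by (intro Abs_poly_mapping_inverse) (auto intro: finite_subset[of _ M])
  have "mpoly_eval p x = (\<Sum>m\<in>M. c m * monomial_value x m)"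
    unfolding mpoly_eval_def monomial_value_def using \<open>finite M\<close>
    by (intro sum.mono_neutral_cong_left) (auto simp: lookup in_keys_iff split: if_splits)
  then have "mpoly_eval p x = 0" using sum by simp
  moreover have "range (Poly_Mapping.lookup p) \<subseteq> K"
    using c \<open>0 \<in> K\<close> by (auto simp: lookup)
  ultimately have "p = 0" using ind unfolding alg_independent_def by blast
  then show ?thesis using lookup \<open>m \<in> M\<close> by (metis lookup_zero)
qed

text \<open>
  The ring of polynomial expressions over \<open>K\<close> in the variables \<open>x v\<close> with \<open>v \<in> S\<close>, provided that
  \<open>K\<close> is a subring.
\<close>

definition monomial_span :: "'a::comm_ring_1 set \<Rightarrow> ('v \<Rightarrow> 'a) \<Rightarrow> 'v set \<Rightarrow> 'a set" where
  "monomial_span K x S =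
     {(\<Sum>m\<in>M. c m * monomial_value x m) | M c.
        finite M \<and> (\<forall>m\<in>M. c m \<in> K \<and> Poly_Mapping.keys m \<subseteq> S)}"

lemma monomial_spanI:
  "a \<in> K \<Longrightarrow> Poly_Mapping.keys m \<subseteq> S \<Longrightarrow> a * monomial_value x m \<in> monomial_span K x S"
  unfolding monomial_span_def
  by (intro CollectI exI[of _ "{m}"] exI[of _ "\<lambda>_. a"]) auto

lemma subring_set_monomial_span:
  assumes K: "subring_set K"
  shows "subring_set (monomial_span K x S)" (is "subring_set ?R")
proof -
  note cl = subring_set_closed[OF K]
  have zero: "0 \<in> ?R"
    using monomial_spanI[of 0 K 0 S x] cl by (simp add: monomial_value_zero)
  have one: "1 \<in> ?R"
    using monomial_spanI[of 1 K 0 S x] cl by (simp add: monomial_value_zero)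
  have add: "a + b \<in> ?R" if a: "a \<in> ?R" and b: "b \<in> ?R" for a b
  proof -
    obtain M c where M: "finite M" "\<forall>m\<in>M. c m \<in> K \<and> Poly_Mapping.keys m \<subseteq> S"
      "a = (\<Sum>m\<in>M. c m * monomial_value x m)"
      using a unfolding monomial_span_def by blast
    obtain N d where N: "finite N" "\<forall>m\<in>N. d m \<in> K \<and> Poly_Mapping.keys m \<subseteq> S"
      "b = (\<Sum>m\<in>N. d m * monomial_value x m)"
      using b unfolding monomial_span_def by blast
    define e where "e m = (if m \<in> M then c m else 0) + (if m \<in> N then d m else 0)" for m
    have "a = (\<Sum>m\<in>M \<union> N. (if m \<in> M then c m else 0) * monomial_value x m)"
      unfolding M(3) using M(1) N(1) by (intro sum.mono_neutral_cong_left) auto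
    moreover have "b = (\<Sum>m\<in>M \<union> N. (if m \<in> N then d m else 0) * monomial_value x m)"
      unfolding N(3) using M(1) N(1) by (intro sum.mono_neutral_cong_left) auto
    ultimately have "a + b = (\<Sum>m\<in>M \<union> N. e m * monomial_value x m)"
      by (simp add: e_def distrib_right sum.distrib)
    moreover have "\<forall>m\<in>M \<union> N. e m \<in> K \<and> Poly_Mapping.keys m \<subseteq> S"
      using M(2) N(2) by (auto simp: e_def intro: cl)
    ultimately show ?thesis
      unfolding monomial_span_def using M(1) N(1) by blast
  qed
  have sum: "sum f I \<in> ?R" if "\<And>i. i \<in> I \<Longrightarrow> f i \<in> ?R" for f and I :: "('b \<Rightarrow>\<^sub>0 nat) set"
    using that by (induction I rule: infinite_finite_induct) (auto intro: zero add)
  have mult: "a * b \<in> ?R" if a: "a \<in> ?R" and b: "b \<in> ?R" for a b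
  proof -
    obtain M c where M: "\<forall>m\<in>M. c m \<in> K \<and> Poly_Mapping.keys m \<subseteq> S"
      "a = (\<Sum>m\<in>M. c m * monomial_value x m)"
      using a unfolding monomial_span_def by blast
    obtain N d where N: "\<forall>m\<in>N. d m \<in> K \<and> Poly_Mapping.keys m \<subseteq> S"
      "b = (\<Sum>m\<in>N. d m * monomial_value x m)"
      using b unfolding monomial_span_def by blast
    have "a * b = (\<Sum>m\<in>M. \<Sum>n\<in>N. (c m * d n) * monomial_value x (m + n))"
      unfolding M N sum_product by (simp add: monomial_value_add mult_ac)
    also have "\<dots> \<in> ?R"
      using M(1) N(1) Poly_Mapping.keys_add by (intro sum monomial_spanI cl) fast+
    finally show ?thesis .
  qed
  have "- a \<in> ?R" if a: "a \<in> ?R" for a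
    using mult[OF _ a, of "- 1"] monomial_spanI[of "- 1" K 0 S x] cl by (simp add: monomial_value_zero)
  then show ?thesis
    unfolding subring_set_def using zero one add mult by blast
qed

text \<open>
  The monomials in the variables from \<open>S\<close>, multiplied by different powers of the further variable
  \<open>x v\<close>, are pairwise different monomials. So a relation for \<open>x v\<close> expands into a linear relation
  between different monomials, whose coefficients must all vanish.
\<close>

lemma alg_independent_poly_over_monomial_span:
  assumes ind: "alg_independent K x" and "0 \<in> K" and "v \<notin> S"
    and p: "p \<in> polys_over (monomial_span K x S)" and root: "poly p (x v) = 0"
  shows "p = 0"
proof -
  have "\<forall>i. \<exists>M c. finite M \<and> (\<forall>m\<in>M. c m \<in> K \<and> Poly_Mapping.keys m \<subseteq> S) \<and>
      coeff p i = (\<Sum>m\<in>M. c m * monomial_value x m)"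
    using p unfolding polys_over_def monomial_span_def by fastforce
  then obtain M c where M: "\<And>i. finite (M i)"
    "\<And>i m. m \<in> M i \<Longrightarrow> c i m \<in> K \<and> Poly_Mapping.keys m \<subseteq> S"
    "\<And>i. coeff p i = (\<Sum>m\<in>M i. c i m * monomial_value x m)"
    by metis
  define I where "I = Sigma {..degree p} M"
  define g where "g = (\<lambda>(i, m). m + Poly_Mapping.single v (i :: nat))"
  have fin: "finite I" unfolding I_def using M(1) by auto
  have v: "Poly_Mapping.lookup m v = 0" if "m \<in> M i" for i m
    using M(2)[OF that] \<open>v \<notin> S\<close> by (auto simp: in_keys_iff)
  have inj: "inj_on g I"
  proof (rule inj_onI, clarsimp simp: I_def g_def)
    fix i m j n
    assume "m \<in> M i" "n \<in> M j"
      and eq: "m + Poly_Mapping.single v i = n + Poly_Mapping.single v j"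
    have "Poly_Mapping.lookup (m + Poly_Mapping.single v i) v = i"
      "Poly_Mapping.lookup (n + Poly_Mapping.single v j) v = j"
      using v \<open>m \<in> M i\<close> \<open>n \<in> M j\<close> by (simp_all add: lookup_add)
    then have "i = j" using eq by simp
    then show "i = j \<and> m = n" using eq by simp
  qed
  \<comment> \<open>Index the coefficients by the product monomials: \<open>d (g (i, m)) = c i m\<close>.\<close>
  define h where "h = the_inv_into I g"
  have hg: "h (g im) = im" if "im \<in> I" for im
    unfolding h_def using the_inv_into_f_f[OF inj that] .
  define d where "d n = (case h n of (i, m) \<Rightarrow> c i m)" for n
  have "0 = (\<Sum>i\<le>degree p. \<Sum>m\<in>M i. c i m * monomial_value x m * x v ^ i)"
    using root by (simp add: poly_altdef M(3) sum_distrib_right)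
  also have "\<dots> = (\<Sum>(i, m)\<in>I. c i m * monomial_value x m * x v ^ i)"
    unfolding I_def using M(1) by (intro sum.Sigma) auto
  also have "\<dots> = (\<Sum>im\<in>I. d (g im) * monomial_value x (g im))"
    by (intro sum.cong)
      (auto simp: d_def hg, auto simp: g_def monomial_value_add monomial_value_single)
  also have "\<dots> = (\<Sum>n\<in>g ` I. d n * monomial_value x n)"
    by (simp add: sum.reindex[OF inj])
  finally have sum: "(\<Sum>n\<in>g ` I. d n * monomial_value x n) = 0" ..
  have "c i m = 0" if "i \<le> degree p" "m \<in> M i" for i m
  proof -
    have im: "(i, m) \<in> I" using that by (auto simp: I_def)
    have "d (g (i, m)) = 0"
    proof (rule alg_independent_monomials[OF ind \<open>0 \<in> K\<close> _ _ sum])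
      show "finite (g ` I)" using fin by simp
      show "d n \<in> K" if "n \<in> g ` I" for n
        using that M(2) by (auto simp: d_def hg I_def)
      show "g (i, m) \<in> g ` I" using im by simp
    qed
    then show ?thesis by (simp add: d_def hg im)
  qed
  then have "coeff p i = 0" if "i \<le> degree p" for i
    using that by (simp add: M(3))
  then show "p = 0" by (metis leading_coeff_0_iff order_refl)
qed

lemma common_denominator:
  fixes R :: "'a::field set"
  assumes R: "subring_set R" and "finite A" and "A \<subseteq> {a / b | a b. a \<in> R \<and> b \<in> R}"
  shows "\<exists>d\<in>R. d \<noteq> 0 \<and> (\<forall>a\<in>A. d * a \<in> R)"
  using assms(2,3)
proof (induction A rule: finite_induct)
  case empty
  then show ?case using subring_set_closed(2)[OF R] by (auto intro!: bexI[of _ 1])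
next
  case (insert z A)
  then obtain d where d: "d \<in> R" "d \<noteq> 0" "\<forall>a\<in>A. d * a \<in> R" by auto
  obtain a b where ab: "z = a / b" "a \<in> R" "b \<in> R" using insert.prems by auto
  show ?case
  proof (cases "b = 0")
    case True
    then show ?thesis using d ab subring_set_closed(1)[OF R] by (intro bexI[of _ d]) auto
  next
    case False
    have "d * b * u \<in> R" if "u \<in> insert z A" for u
    proof (cases "u = z")
      case True
      then have "d * b * u = d * a" using \<open>b \<noteq> 0\<close> ab by simp
      then show ?thesis using subring_set_closed(4)[OF R d(1) ab(2)] by (simp only:)
    next
      case False
      then have "b * (d * u) \<in> R" using subring_set_closed(4)[OF R] d ab that by simp
      then show ?thesis by (simp add: mult_ac)
    qed
    then show ?thesis using False d ab subring_set_closed(4)[OF R]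
      by (intro bexI[of _ "d * b"]) auto
  qed
qed

text \<open>
  Elements of the field generated by \<open>E\<close> and \<open>x ` S\<close> are fractions of polynomial expressions;
  multiplying a relation for \<open>x v\<close> by a common denominator reduces to coefficients that are
  polynomial expressions.
\<close>

lemma alg_independent_transcendental:
  fixes x :: "'v \<Rightarrow> 'a::field"
  assumes ind: "alg_independent E x" and E: "subfield_set E" and "v \<notin> S"
    and p: "p \<in> polys_over (subfield_gen (E \<union> x ` S))" and root: "poly p (x v) = 0"
  shows "p = 0"
proof -
  let ?R = "monomial_span E x S"
  note E' = subfield_set_imp_subring_set[OF E]
  have R: "subring_set ?R" by (rule subring_set_monomial_span[OF E'])
  note cl = subring_set_closed[OF E'] subring_set_closed[OF R]
  have "a \<in> ?R" if "a \<in> E \<union> x ` S" for a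
  proof (cases "a \<in> E")
    case True
    then show ?thesis using monomial_spanI[of a E 0 S x] by (simp add: monomial_value_zero)
  next
    case False
    then obtain w where "a = x w" "w \<in> S"
      using \<open>a \<in> E \<union> x ` S\<close> by blast
    then show ?thesis
      using monomial_spanI[of 1 E "Poly_Mapping.single w 1" S x] cl
      by (simp add: monomial_value_single)
  qed
  then have "E \<union> x ` S \<subseteq> {a / b | a b. a \<in> ?R \<and> b \<in> ?R}"
    by (intro subset_fractions[OF cl(8)] subsetI)
  then have "subfield_gen (E \<union> x ` S) \<subseteq> {a / b | a b. a \<in> ?R \<and> b \<in> ?R}"
    by (rule subfield_gen_least[OF subfield_set_fractions[OF R]])
  then have "coeff p ` {..degree p} \<subseteq> {a / b | a b. a \<in> ?R \<and> b \<in> ?R}"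
    using p unfolding polys_over_def by blast
  from common_denominator[OF R _ this]
  obtain d where d: "d \<noteq> 0" "\<And>i. i \<le> degree p \<Longrightarrow> d * coeff p i \<in> ?R" by auto
  have "d * coeff p i \<in> ?R" for i
    using d(2) cl(7) by (cases "i \<le> degree p") (auto simp: coeff_eq_0)
  then have "smult d p = 0"
    using root by (intro alg_independent_poly_over_monomial_span[OF ind cl(1) \<open>v \<notin> S\<close>])
      (auto simp: polys_over_def)
  then show ?thesis using d(1) by simp
qed

lemma alg_independent_linear:
  fixes x :: "'v \<Rightarrow> 'a::field"
  assumes "alg_independent E x" "subfield_set E" "v \<notin> S"
    and "a \<in> subfield_gen (E \<union> x ` S)" "b \<in> subfield_gen (E \<union> x ` S)" "a + b * x v = 0"
  shows "a = 0" "b = 0"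
proof -
  note 0 = subfield_set_closed(1)[OF subfield_set_subfield_gen]
  have "[:a, b:] \<in> polys_over (subfield_gen (E \<union> x ` S))"
    by (intro pCons_polys_over 0 assms) (simp add: polys_over_def 0)
  then have "[:a, b:] = 0"
    using assms by (intro alg_independent_transcendental[OF assms(1-3)]) (auto simp: mult.commute)
  then show "a = 0" "b = 0" by auto
qed

lemma alg_independent_notin:
  fixes x :: "'v \<Rightarrow> 'a::field"
  assumes "alg_independent E x" "subfield_set E" "v \<notin> S"
  shows "x v \<notin> subfield_gen (E \<union> x ` S)"
proof
  note cl = subfield_set_closed[OF subfield_set_subfield_gen]
  assume "x v \<in> subfield_gen (E \<union> x ` S)"
  then show False
    using alg_independent_linear(2)[OF assms cl(5) cl(2)] by fastforce
qed

section \<open>Derivations and a transcendental element with transcendental derivative\<close>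

lemma derivation_rules:
  assumes "derivation D"
  shows "D (x + y) = D x + D y" "D (x * y) = D x * y + x * D y"
    and "D 0 = 0" "D 1 = 0" "D (- x) = - D x" "D (x - y) = D x - D y"
    and "D (inverse x) = - D x * inverse x ^ 2"
    and "D (of_int n) = 0"
proof -
  show add: "D (x + y) = D x + D y" and mult: "D (x * y) = D x * y + x * D y" for x y
    using assms by (auto simp: derivation_def)
  show zero: "D 0 = 0" using add[of 0 0] by (metis add_0 add_cancel_right_right)
  show one: "D 1 = 0" using mult[of 1 1] by (metis add_cancel_right_right mult_1 mult.right_neutral)
  show neg: "D (- x) = - D x" for x
    using add[of x "- x"] zero by (simp add: eq_neg_iff_add_eq_0 add.commute)
  show "D (x - y) = D x - D y" using add[of x "- y"] neg by simp
  show "D (inverse x) = - D x * inverse x ^ 2"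
  proof (cases "x = 0")
    case True
    then show ?thesis using zero by simp
  next
    case False
    then have "D x * inverse x + x * D (inverse x) = 0"
      using mult[of x "inverse x"] one by simp
    then show ?thesis using False by (simp add: field_simps power2_eq_square eq_neg_iff_add_eq_0)
  qed
  have nat: "D (of_nat k) = 0" for k by (induction k) (auto simp: zero one add)
  show "D (of_int n) = 0" by (cases n) (auto simp: nat neg simp del: of_nat_Suc)
qed

text \<open>
  The elements of \<open>K\<close> with derivative in \<open>K\<close> form a subfield, so it suffices to look at generators.
\<close>

lemma derivation_subfield_gen:
  assumes D: "derivation D" and "S \<subseteq> K" and "\<And>a. a \<in> S \<Longrightarrow> D a \<in> K"
    and K: "subfield_set K" and "a \<in> subfield_gen S"
  shows "D a \<in> K"
proof -
  note cl = subfield_set_closed[OF K]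
  have "subfield_set {a \<in> K. D a \<in> K}"
    unfolding subfield_set_def by (auto simp: derivation_rules[OF D] intro!: cl)
  from subfield_gen_least[OF this, of S] show ?thesis using assms by blast
qed

lemma derivation_poly:
  assumes D: "derivation D"
  shows "D (poly p t) = poly (map_poly D p) t + poly (pderiv p) t * D t"
  by (induction p)
    (auto simp: derivation_rules[OF D] map_poly_pCons pderiv_pCons algebra_simps)

text \<open>
  Vanishing of the Wronskian means that the derivative of \<open>p / q\<close> is zero. If \<open>p\<close> and \<open>q\<close> are
  nonzero, their leading terms force equal degrees in characteristic zero. The difference of \<open>p\<close>
  and the multiple of \<open>q\<close> with the same leading coefficient has lower degree, yet satisfies the
  same relation, so it vanishes.
\<close>

lemma wronskian_eq_0_imp_smult:
  fixes p q :: "'a::field_char_0 poly"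
  assumes W: "pderiv p * q = p * pderiv q" and "q \<noteq> 0"
  shows "p = smult (lead_coeff p / lead_coeff q) q"
proof (cases "p = 0")
  case False
  have lead_pderiv: "lead_coeff (pderiv f) = of_nat (degree f) * lead_coeff f" for f :: "'a poly"
    by (cases "degree f") (auto simp: degree_pderiv coeff_pderiv coeff_eq_0)
  have degree_eq: "degree f = degree q" if W: "pderiv f * q = f * pderiv q" and "f \<noteq> 0" for f
  proof -
    have "lead_coeff (pderiv f * q) = lead_coeff (f * pderiv q)" using W by simp
    then show ?thesis using \<open>f \<noteq> 0\<close> \<open>q \<noteq> 0\<close> by (simp add: lead_coeff_mult lead_pderiv)
  qed
  define a where "a = lead_coeff p / lead_coeff q"
  define h where "h = p - smult a q"
  have "h = 0"
  proof (rule ccontr)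
    assume "h \<noteq> 0"
    have "pderiv h * q = h * pderiv q"
      using W by (simp add: h_def pderiv_diff pderiv_smult algebra_simps)
    then have "degree h = degree q" using \<open>h \<noteq> 0\<close> degree_eq by blast
    moreover have "coeff h (degree q) = 0"
      using degree_eq[OF W False] \<open>q \<noteq> 0\<close> by (simp add: h_def a_def)
    ultimately show False using \<open>h \<noteq> 0\<close> by (metis leading_coeff_0_iff)
  qed
  then show ?thesis by (simp add: h_def a_def)
qed simp

text \<open>
  For \<open>y = p(t) / q(t)\<close>, the derivative of \<open>y\<close> is linear in \<open>D t\<close>, with coefficient
  \<open>(p' q - p q')(t) / q(t)\<^sup>2\<close> and all other terms in \<open>K(t)\<close>. If \<open>D y\<close> lies in \<open>K(t)\<close> but \<open>D t\<close> does
  not, then this coefficient must be zero, and \<open>y\<close> is free of \<open>t\<close>.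
\<close>

lemma derivation_drops_transcendental:
  fixes D :: "'a::field_char_0 \<Rightarrow> 'a"
  assumes D: "derivation D" and K: "subfield_set K"
    and transc: "\<And>p. p \<in> polys_over K \<Longrightarrow> poly p t = 0 \<Longrightarrow> p = 0"
    and DK: "\<And>a. a \<in> K \<Longrightarrow> D a \<in> subfield_gen (insert t K)"
    and Dt: "D t \<notin> subfield_gen (insert t K)"
    and y: "y \<in> subfield_gen (insert t K)" and Dy: "D y \<in> subfield_gen (insert t K)"
  shows "y \<in> K"
proof (cases "y = 0")
  case True
  then show ?thesis using subfield_set_closed[OF K] by simp
next
  case False
  let ?L = "subfield_gen (insert t K)"
  note K' = subfield_set_imp_subring_set[OF K]
  have L: "subfield_set ?L" by (rule subfield_set_subfield_gen)
  note clL = subfield_set_closed[OF L]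
  have KL: "K \<subseteq> ?L" and tL: "t \<in> ?L" using subfield_gen_superset[of "insert t K"] by auto
  obtain p q where p: "p \<in> polys_over K" and q: "q \<in> polys_over K"
    and y_eq: "y = poly p t / poly q t"
    using subfield_gen_insert_fraction[OF K y] .
  have eval: "poly f t \<in> ?L" if "f \<in> polys_over ?L" for f
    using poly_in_subring_set[OF subfield_set_imp_subring_set[OF L] that tL] .
  have over: "f \<in> polys_over ?L" "map_poly D f \<in> polys_over ?L" "pderiv f \<in> polys_over ?L"
    if "f \<in> polys_over K" for f
    using that KL DK pderiv_polys_over[OF K' that]
    by (auto simp: polys_over_def coeff_map_poly derivation_rules[OF D])
  define w where "w = pderiv p * q - p * pderiv q"
  have nz: "poly q t \<noteq> 0" using False y_eq by auto
  then have "D y * poly q t + y * D (poly q t) = D (poly p t)"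
    using derivation_rules(2)[OF D, of y "poly q t"] y_eq by simp
  then have "poly q t * (D y * poly q t + y * D (poly q t)) = poly q t * D (poly p t)"
    by simp
  then have "D y * poly q t * poly q t + (y * poly q t) * D (poly q t) = poly q t * D (poly p t)"
    by (simp add: algebra_simps)
  then have "D y * poly q t * poly q t + poly p t * D (poly q t) = poly q t * D (poly p t)"
    using y_eq nz by simp
  then have key: "poly w t * D t = D y * poly q t * poly q t
      + poly p t * poly (map_poly D q) t - poly q t * poly (map_poly D p) t"
    by (simp add: w_def derivation_poly[OF D] algebra_simps)
  have "poly w t * D t \<in> ?L"
    unfolding key by (intro clL Dy eval over p q)
  moreover have "poly w t \<in> ?L"
    unfolding w_def by (simp, intro clL eval over p q)
  ultimately have "poly w t * D t / poly w t \<in> ?L" by (rule clL)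
  then have "poly w t = 0" using Dt by (cases "poly w t = 0") auto
  moreover have "w \<in> polys_over K"
    unfolding w_def by (intro subring_set_closed[OF subring_set_polys_over[OF K']]
        pderiv_polys_over[OF K'] p q)
  ultimately have "w = 0" by (rule transc[rotated])
  then have "p = smult (lead_coeff p / lead_coeff q) q"
    using nz by (intro wronskian_eq_0_imp_smult) (auto simp: w_def)
  then have "poly p t = lead_coeff p / lead_coeff q * poly q t"
    by (metis poly_smult)
  then have "y = lead_coeff p / lead_coeff q" using y_eq nz by simp
  then show ?thesis using p q subfield_set_closed[OF K] by (auto simp: polys_over_def)
qed


section \<open>Elimination of a differential indeterminate\<close>

text \<open>
  The field generated over \<open>E\<close> by the derivatives of order \<open>k\<close> of \<open>r i\<close> with \<open>(i, k) \<in> T\<close>. A set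
  of index pairs, rather than one bound on the order, makes it possible to count the order in one
  indeterminate while all derivatives of the others are present.
\<close>

definition jet_field ::
    "('a::field \<Rightarrow> 'a) \<Rightarrow> 'a set \<Rightarrow> ('i \<Rightarrow> 'a) \<Rightarrow> ('i \<times> nat) set \<Rightarrow> 'a set" where
  "jet_field D E r T = subfield_gen (E \<union> (\<lambda>(i, k). (D ^^ k) (r i)) ` T)"

lemma subfield_set_jet_field: "subfield_set (jet_field D E r T)"
  unfolding jet_field_def by (rule subfield_set_subfield_gen)

lemma jet_field_mono: "T \<subseteq> T' \<Longrightarrow> jet_field D E r T \<subseteq> jet_field D E r T'"
  unfolding jet_field_def by (intro subfield_gen_mono) auto

lemma jet_field_base: "E \<subseteq> jet_field D E r T"
  unfolding jet_field_def using subfield_gen_superset by fast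

lemma jet_field_member: "(i, k) \<in> T \<Longrightarrow> (D ^^ k) (r i) \<in> jet_field D E r T"
  unfolding jet_field_def using subfield_gen_superset by fastforce

lemma jet_field_insert:
  "jet_field D E r (insert (i, k) T) \<subseteq> subfield_gen (insert ((D ^^ k) (r i)) (jet_field D E r T))"
  unfolding jet_field_def
  by (rule subfield_gen_least[OF subfield_set_subfield_gen])
    (use subfield_gen_superset[of "E \<union> (\<lambda>(i, k). (D ^^ k) (r i)) ` T"]
      subfield_gen_superset[of "insert ((D ^^ k) (r i)) (subfield_gen (E \<union> (\<lambda>(i, k). (D ^^ k) (r i)) ` T))"]
      in fastforce)

lemma jet_field_insert_eq:
  "subfield_gen (insert ((D ^^ k) (r i)) (jet_field D E r T)) = jet_field D E r (insert (i, k) T)"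
  using jet_field_mono[of T "insert (i, k) T" D E r] jet_field_member[of i k "insert (i, k) T" D r E]
  by (intro subset_antisym jet_field_insert subfield_gen_least subfield_set_jet_field) auto

lemma derivation_jet_field:
  assumes D: "derivation D" and E: "diff_subfield D E" and "T \<subseteq> T'"
    and shift: "\<And>i k. (i, k) \<in> T \<Longrightarrow> (i, Suc k) \<in> T'" and a: "a \<in> jet_field D E r T"
  shows "D a \<in> jet_field D E r T'"
proof (rule derivation_subfield_gen[OF D _ _ subfield_set_jet_field a[unfolded jet_field_def]])
  show "E \<union> (\<lambda>(i, k). (D ^^ k) (r i)) ` T \<subseteq> jet_field D E r T'"
    using jet_field_base[of E D r T'] jet_field_member[of _ _ T' D r E] \<open>T \<subseteq> T'\<close> by auto
  show "D b \<in> jet_field D E r T'" if "b \<in> E \<union> (\<lambda>(i, k). (D ^^ k) (r i)) ` T" for b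
    using that
  proof
    assume "b \<in> E"
    then show ?thesis using E jet_field_base unfolding diff_subfield_def by blast
  next
    assume "b \<in> (\<lambda>(i, k). (D ^^ k) (r i)) ` T"
    then obtain i k where "(i, k) \<in> T" "b = (D ^^ k) (r i)" by auto
    then show ?thesis using jet_field_member[OF shift, of i k D r E] by simp
  qed
qed

text \<open>
  Each element of the differential field involves only finitely many derivatives: the fields of
  bounded order in \<open>r j\<close> form a chain whose union is closed under \<open>D\<close>.
\<close>

lemma diff_field_gen_subset_jets:
  assumes D: "derivation D" and E: "diff_subfield D E"
  shows "diff_field_gen D (E \<union> range r) \<subseteq> (\<Union>n. jet_field D E r {(i, k). i = j \<longrightarrow> k < n})"
    (is "_ \<subseteq> (\<Union>n. ?J n)")
proof -
  note cl = subfield_set_closed[OF subfield_set_jet_field]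
  have mono: "?J m \<subseteq> ?J n" if "m \<le> n" for m n
    using that by (intro jet_field_mono) auto
  have common: "\<exists>n. a \<in> ?J n \<and> b \<in> ?J n" if "a \<in> (\<Union>n. ?J n)" "b \<in> (\<Union>n. ?J n)" for a b
  proof -
    obtain m n where "a \<in> ?J m" "b \<in> ?J n" using \<open>a \<in> _\<close> \<open>b \<in> _\<close> by blast
    then have "a \<in> ?J (max m n)" "b \<in> ?J (max m n)"
      using mono[of m "max m n"] mono[of n "max m n"] by auto
    then show ?thesis by blast
  qed
  have "subfield_set (\<Union>n. ?J n)"
    unfolding subfield_set_def
  proof (intro conjI ballI)
    show "0 \<in> (\<Union>n. ?J n)" "1 \<in> (\<Union>n. ?J n)" by (rule UN_I[OF UNIV_I], rule cl)+
    show "a + b \<in> (\<Union>n. ?J n)" "a * b \<in> (\<Union>n. ?J n)"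
      if "a \<in> (\<Union>n. ?J n)" "b \<in> (\<Union>n. ?J n)" for a b
      using common[OF that] by (auto intro: cl(3,4))
    show "- a \<in> (\<Union>n. ?J n)" "inverse a \<in> (\<Union>n. ?J n)" if "a \<in> (\<Union>n. ?J n)" for a
      using that by (auto intro: cl(5,7))
  qed
  moreover have "D a \<in> ?J (Suc n)" if "a \<in> ?J n" for a n
    by (rule derivation_jet_field[OF D E _ _ that]) auto
  ultimately have "diff_subfield D (\<Union>n. ?J n)"
    unfolding diff_subfield_def by blast
  moreover have "E \<union> range r \<subseteq> (\<Union>n. ?J n)"
  proof -
    have "r i \<in> ?J 1" for i
      using jet_field_member[of i 0 "{(i, k). i = j \<longrightarrow> k < 1}" D r E] by simp
    then show ?thesis using jet_field_base[of E D r] by blast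
  qed
  ultimately show ?thesis unfolding diff_field_gen_def by blast
qed

text \<open>
  If the derivatives of the elements of \<open>Z\<close> never have a higher order in \<open>r j\<close> than \<open>Z\<close> itself,
  then \<open>r j\<close> does not occur in \<open>Z\<close> at all: the highest derivative of \<open>r j\<close> that occurs would be
  raised by \<open>D\<close>. The bound \<open>n > 0\<close> in the hypothesis leaves room for \<open>r j\<close> itself, so it may occur
  in the expressions for the derivatives of \<open>Z\<close>.
\<close>

lemma diff_indeterminate_absent:
  fixes D :: "'a::field_char_0 \<Rightarrow> 'a"
  assumes D: "derivation D" and E: "diff_subfield D E" and ind: "diff_indeterminates D E r"
    and "finite Z" and Z: "Z \<subseteq> diff_field_gen D (E \<union> range r)"
    and stable: "\<And>n. n > 0 \<Longrightarrow> Z \<subseteq> jet_field D E r {(i, k). i = j \<longrightarrow> k < n} \<Longrightarrow>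
      D ` Z \<subseteq> jet_field D E r {(i, k). i = j \<longrightarrow> k < n}"
  shows "Z \<subseteq> jet_field D E r {(i, k). i \<noteq> j}"
proof -
  define T where "T n = {(i, k). i = j \<longrightarrow> k < n}" for n :: nat
  let ?J = "\<lambda>n. jet_field D E r (T n)"
  have T_Suc: "T (Suc n) = insert (j, n) (T n)" for n
    unfolding T_def by auto
  have E': "subfield_set E" using E by (simp add: diff_subfield_def)
  note ind' = ind[unfolded diff_indeterminates_def]
  have mono: "?J m \<subseteq> ?J n" if "m \<le> n" for m n
    using that by (intro jet_field_mono) (auto simp: T_def)
  have "\<exists>n. Z \<subseteq> ?J n"
    using \<open>finite Z\<close> Z
  proof (induction Z rule: finite_induct)
    case (insert z Z)
    then obtain n where "Z \<subseteq> ?J n" by auto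
    moreover obtain m where "z \<in> ?J m"
      using insert.prems diff_field_gen_subset_jets[OF D E, of r j] unfolding T_def by blast
    ultimately have "insert z Z \<subseteq> ?J (max m n)"
      using mono[of m "max m n"] mono[of n "max m n"] by auto
    then show ?case by blast
  qed simp
  then obtain N where N: "Z \<subseteq> ?J N" by blast
  \<comment> \<open>With \<open>r j\<close> bounded by order \<open>n\<close>, the derivative of order \<open>n + 1\<close> is still transcendental, so the
    one of order \<open>n\<close> can be dropped.\<close>
  have down: "Z \<subseteq> ?J n" if "Z \<subseteq> ?J (Suc n)" for n
  proof
    fix z assume "z \<in> Z"
    let ?t = "(D ^^ n) (r j)"
    have L: "subfield_gen (insert ?t (?J n)) = ?J (Suc n)"
      unfolding T_Suc by (rule jet_field_insert_eq)
    show "z \<in> ?J n"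
    proof (rule derivation_drops_transcendental[OF D subfield_set_jet_field, of _ _ _ _ ?t], unfold L)
      show "p = 0" if "p \<in> polys_over (?J n)" "poly p ?t = 0" for p
        using that alg_independent_transcendental[OF ind' E', of "(j, n)" "T n" p]
        by (simp add: jet_field_def T_def)
      show "D a \<in> ?J (Suc n)" if "a \<in> ?J n" for a
        by (rule derivation_jet_field[OF D E _ _ that]) (auto simp: T_def)
      show "D ?t \<notin> ?J (Suc n)"
        using alg_independent_notin[OF ind' E', of "(j, Suc n)" "T (Suc n)"]
        by (simp add: jet_field_def T_def)
      show "z \<in> ?J (Suc n)" using \<open>z \<in> Z\<close> that by blast
      show "D z \<in> ?J (Suc n)" using \<open>z \<in> Z\<close> stable[of "Suc n"] that unfolding T_def by blast
    qed
  qed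
  have "Z \<subseteq> ?J (N - n)" for n
  proof (induction n)
    case (Suc n)
    show ?case
    proof (cases "n < N")
      case True
      then show ?thesis using Suc down[of "N - Suc n"] by (simp add: Suc_diff_Suc)
    next
      case False
      then show ?thesis using Suc by simp
    qed
  qed (use N in simp)
  from this[of N] have "Z \<subseteq> ?J 0" by simp
  moreover have "T 0 = {(i, k). i \<noteq> j}" by (auto simp: T_def)
  ultimately show ?thesis by simp
qed

section \<open>The Riccati equation\<close>

text \<open>
  The source of the contradiction is the product \<open>D r2 * r1\<close>: \<open>r2\<close> has order one in \<open>c0\<close>, but order
  zero in \<open>c1\<close> and \<open>c2\<close>. The terms linear in \<open>r1\<close> force \<open>P = (b + w)\<^sup>m\<close> with \<open>w\<close> of order exactly one
  in \<open>r2\<close>, and the terms free of \<open>r1\<close> say that \<open>D w\<close> has order at most one.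
\<close>

lemma riccati_no_darboux_polynomial:
  fixes D :: "'a::field_char_0 \<Rightarrow> 'a" and r1 r2 :: 'a and E :: "'a set" and m :: int
    and y :: "int \<Rightarrow> 'a"
  defines "r \<equiv> (\<lambda>i::2. if i = 1 then r1 else r2)"
  defines "L \<equiv> subfield_gen (insert r2 E)"
  assumes D: "derivation D" and E: "diff_subfield D E" and ind: "diff_indeterminates D E r"
    and coeffs: "c2 \<in> L" "c10 \<in> L" "c11 \<in> L" "c00 \<in> L" "g \<in> L"
    and c1: "c1 = c10 + c11 * r1"
    and c0: "c0 = c00 + (g - D r2) * r1"
    and "m > 0"
    and y: "\<And>k. k \<in> {0..<m} \<Longrightarrow> y k \<in> diff_field_gen D (E \<union> {r1, r2})"
    and y_top: "y m = 1" and y_bot: "y (-1) = 0"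
    and ode: "\<And>k. k \<in> {0..<m} \<Longrightarrow>
       D (y k) = (c2 * y (m - 1) - of_int m * c1 + of_int k * c1) * y k
                        + of_int (k - m - 1) * c2 * y (k - 1)
                        + of_int (k + 1) * c0 * y (k + 1)"
  shows False
proof -
  have E': "subfield_set E" using E by (simp add: diff_subfield_def)
  note ind' = ind[unfolded diff_indeterminates_def]
  have r_simps: "r 1 = r1" "r 2 = r2" by (simp_all add: r_def)
  have range_r: "range r = {r1, r2}"
    by (simp add: UNIV_2 r_simps)
  let ?M = "\<lambda>n. {(2::2, k) | k. k < (n::nat)}"
  have LM: "L = jet_field D E r (?M 1)"
    unfolding L_def jet_field_def by (rule arg_cong[of _ _ subfield_gen]) (auto simp: r_simps)
  define K where "K = jet_field D E r {(i, k). i \<noteq> 1}"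
  have clK: "subfield_set K" unfolding K_def by (rule subfield_set_jet_field)
  note clK = subfield_set_closed[OF clK]
  have coeffs_jet: "c2 \<in> jet_field D E r T" "c10 \<in> jet_field D E r T" "c11 \<in> jet_field D E r T"
    "c00 \<in> jet_field D E r T" "g \<in> jet_field D E r T" if "(2, 0) \<in> T" for T
  proof -
    have "L \<subseteq> jet_field D E r T"
      unfolding LM using that by (intro jet_field_mono) auto
    then show "c2 \<in> jet_field D E r T" "c10 \<in> jet_field D E r T" "c11 \<in> jet_field D E r T"
      "c00 \<in> jet_field D E r T" "g \<in> jet_field D E r T"
      using coeffs by blast+
  qed
  have K_coeffs: "c2 \<in> K" "c10 \<in> K" "c11 \<in> K" "c00 \<in> K" "g \<in> K"
    unfolding K_def by (simp_all add: coeffs_jet)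
  have Dr2_jet: "D r2 \<in> jet_field D E r T" if "(2, 1) \<in> T" for T
    using jet_field_member[OF that, of D r E] by (simp add: r_simps)
  have Dr2_K: "D r2 \<in> K" unfolding K_def by (rule Dr2_jet) simp
  \<comment> \<open>The coefficients contain \<open>r1\<close> but none of its derivatives, so \<open>D\<close> cannot raise the order of the
    \<open>y k\<close> in \<open>r1\<close>.\<close>
  have "y ` {0..<m} \<subseteq> K"
    unfolding K_def
  proof (rule diff_indeterminate_absent[OF D E ind])
    show "finite (y ` {0..<m})" by simp
    show "y ` {0..<m} \<subseteq> diff_field_gen D (E \<union> range r)"
      using y by (auto simp: range_r)
    fix n :: nat
    let ?J = "jet_field D E r {(i, k). i = 1 \<longrightarrow> k < n}"
    assume "n > 0" and J: "y ` {0..<m} \<subseteq> ?J"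
    note cl = subfield_set_closed[OF subfield_set_jet_field]
    have "r1 \<in> ?J"
      using jet_field_member[of 1 0 "{(i, k). i = 1 \<longrightarrow> k < n}" D r E] \<open>n > 0\<close>
      by (simp add: r_simps)
    moreover have "c2 \<in> ?J" "c10 \<in> ?J" "c11 \<in> ?J" "c00 \<in> ?J" "g \<in> ?J" "D r2 \<in> ?J"
      by (simp_all add: coeffs_jet Dr2_jet)
    ultimately have c: "c0 \<in> ?J" "c1 \<in> ?J" "c2 \<in> ?J"
      unfolding c0 c1 by (auto intro!: cl)
    have yJ: "y k \<in> ?J" if "k \<in> {-1..m}" for k
    proof -
      have "k = -1 \<or> k = m \<or> k \<in> {0..<m}" using that by auto
      then show ?thesis using J y_top y_bot cl(1,2) by auto
    qed
    show "D ` y ` {0..<m} \<subseteq> ?J"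
    proof clarify
      fix k assume k: "k \<in> {0..<m}"
      show "D (y k) \<in> ?J"
        unfolding ode[OF k] by (intro cl c yJ) (use k in auto)
    qed
  qed
  then have yK: "y k \<in> K" if "k \<in> {-1..m}" for k
  proof -
    have "k = -1 \<or> k = m \<or> k \<in> {0..<m}" using that by auto
    then show ?thesis using \<open>y ` {0..<m} \<subseteq> K\<close> y_top y_bot clK(1,2) by auto
  qed
  have DK: "D a \<in> K" if "a \<in> K" for a
    unfolding K_def by (rule derivation_jet_field[OF D E _ _ that[unfolded K_def]]) auto
  \<comment> \<open>As \<open>r1\<close> is transcendental over \<open>K\<close>, each equation splits into its parts of degree zero and one
    in \<open>r1\<close>.\<close>
  have linear: "a = 0 \<and> b = 0" if "a \<in> K" "b \<in> K" "a + b * r1 = 0" for a b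
    using alg_independent_linear[OF ind' E', of "(1, 0)" "{(i, k). i \<noteq> 1}" a b] that
    by (simp add: K_def jet_field_def r_simps)
  define c01 where "c01 = g - D r2"
  have c01_K: "c01 \<in> K" unfolding c01_def by (intro clK K_coeffs Dr2_K)
  have split: "D (y k) = (c2 * y (m - 1) - of_int m * c10 + of_int k * c10) * y k
          + of_int (k - m - 1) * c2 * y (k - 1) + of_int (k + 1) * c00 * y (k + 1) \<and>
        of_int (m - k) * c11 * y k = of_int (k + 1) * c01 * y (k + 1)"
    if k: "k \<in> {0..<m}" for k
  proof -
    define a where "a = (c2 * y (m - 1) - of_int m * c10 + of_int k * c10) * y k
          + of_int (k - m - 1) * c2 * y (k - 1) + of_int (k + 1) * c00 * y (k + 1) - D (y k)"
    define b where "b = of_int (k + 1) * c01 * y (k + 1) - of_int (m - k) * c11 * y k"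
    have "a + b * r1 = 0"
      unfolding a_def b_def using ode[OF k] unfolding c0 c1 c01_def by (simp add: algebra_simps)
    moreover have "a \<in> K" "b \<in> K"
      unfolding a_def b_def by (intro clK K_coeffs c01_K yK DK; use k in auto)+
    ultimately have "a = 0" "b = 0" using linear by blast+
    then show ?thesis unfolding a_def b_def by simp
  qed
  have notin: "(D ^^ n) r2 \<notin> jet_field D E r (?M n)" for n
    using alg_independent_notin[OF ind' E', of "(2, n)" "?M n"]
    by (simp add: jet_field_def r_simps)
  have "c01 \<noteq> 0"
    using notin[of 1] coeffs(5) unfolding c01_def LM by auto
  have top: "c11 * y (m - 1) = of_int m * c01"
    using split[of "m - 1"] \<open>m > 0\<close> y_top by simp
  have "c11 \<noteq> 0"
    using top \<open>c01 \<noteq> 0\<close> \<open>m > 0\<close> by auto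
  define w where "w = c01 / c11"
  have c01_w: "c01 = c11 * w" unfolding w_def using \<open>c11 \<noteq> 0\<close> by simp
  have y1: "y (m - 1) = of_int m * w"
    using top \<open>c11 \<noteq> 0\<close> unfolding w_def by (simp add: field_simps)
  \<comment> \<open>The next coefficient of \<open>(b + w)\<^sup>m\<close>; for \<open>m = 1\<close> it is the convention \<open>y (-1) = 0\<close>.\<close>
  have y2: "2 * y (m - 2) = of_int m * of_int (m - 1) * w ^ 2"
  proof (cases "m = 1")
    case True
    then show ?thesis using y_bot by simp
  next
    case False
    then have "2 * c11 * y (m - 2) = of_int (m - 1) * c01 * y (m - 1)"
      using split[of "m - 2"] \<open>m > 0\<close> by (simp add: algebra_simps)
    then have "c11 * (2 * y (m - 2)) = c11 * (of_int m * of_int (m - 1) * w ^ 2)"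
      by (simp add: c01_w y1 power2_eq_square algebra_simps)
    then show ?thesis using \<open>c11 \<noteq> 0\<close> by simp
  qed
  \<comment> \<open>The part of the top equation free of \<open>r1\<close> is the Riccati equation for the root \<open>-w\<close>.\<close>
  have "D (y (m - 1)) = c2 * y (m - 1) * y (m - 1) - c10 * y (m - 1)
      - c2 * (2 * y (m - 2)) + of_int m * c00"
    using split[of "m - 1"] \<open>m > 0\<close> y_top by (simp add: algebra_simps)
  also have "\<dots> = of_int m * (c2 * w ^ 2 - c10 * w + c00)"
    unfolding y1 y2 by (simp add: power2_eq_square algebra_simps)
  finally have "of_int m * D w = of_int m * (c2 * w ^ 2 - c10 * w + c00)"
    unfolding y1 by (simp add: derivation_rules[OF D])
  then have Dw: "D w = c2 * w ^ 2 - c10 * w + c00" using \<open>m > 0\<close> by simp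
  let ?P = "jet_field D E r (?M 2)"
  note clP = subfield_set_closed[OF subfield_set_jet_field]
  have P: "c2 \<in> ?P" "c10 \<in> ?P" "c11 \<in> ?P" "c00 \<in> ?P" "g \<in> ?P" "D r2 \<in> ?P"
    by (simp_all add: coeffs_jet Dr2_jet)
  then have wP: "w \<in> ?P" unfolding w_def c01_def by (intro clP)
  have DP: "D c11 \<in> ?P" "D g \<in> ?P"
    by (rule derivation_jet_field[OF D E _ _ coeffs(3)[unfolded LM]]; auto)
      (rule derivation_jet_field[OF D E _ _ coeffs(5)[unfolded LM]]; auto)
  \<comment> \<open>Differentiating \<open>g - D r2 = c11 * w\<close> expresses \<open>D (D r2)\<close> through \<open>r2\<close> and \<open>D r2\<close>.\<close>
  have "D (D r2) = D g - D c01" unfolding c01_def by (simp add: derivation_rules[OF D])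
  also have "\<dots> = D g - (D c11 * w + c11 * D w)"
    by (simp add: c01_w derivation_rules[OF D])
  also have "\<dots> \<in> ?P"
    unfolding Dw by (intro clP DP P wP)
  finally show False using notin[of 2] by (simp add: numeral_2_eq_2)
qed

lemma chevalley_matrix_entries:
  assumes "matrix_entries (chevalley_matrix am a0 ap) \<subseteq> K" and K: "subfield_set K"
  shows "am $ i \<in> K" "a0 $ j \<in> K" "ap $ i \<in> K"
proof -
  let ?A = "chevalley_matrix am a0 ap"
  have entry: "?A $ i $ j \<in> K" for i j
    using assms(1) unfolding matrix_entries_def by blast
  have eqs: "?A $ 2 $ 1 = am $ 1" "?A $ 3 $ 2 = am $ 2" "?A $ 3 $ 1 = am $ 3"
    "?A $ 1 $ 2 = ap $ 1" "?A $ 2 $ 3 = ap $ 2" "?A $ 1 $ 3 = ap $ 3"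
    "?A $ 1 $ 1 = a0 $ 1" "?A $ 3 $ 3 = - (a0 $ 2)"
    unfolding chevalley_matrix_def
    by (simp_all add: sum_3 sum_2 scale_matrix_def map_matrix_def X_neg_def X_pos_def H_diag_def
        unit_matrix_def transpose_def)
  have am: "am $ 1 \<in> K" "am $ 2 \<in> K" "am $ 3 \<in> K"
    and ap: "ap $ 1 \<in> K" "ap $ 2 \<in> K" "ap $ 3 \<in> K" and a0: "a0 $ 1 \<in> K" "- (a0 $ 2) \<in> K"
    using entry by (simp_all flip: eqs)
  have "a0 $ 2 \<in> K" using subfield_set_closed(5)[OF K a0(2)] by simp
  then show "am $ i \<in> K" "a0 $ j \<in> K" "ap $ i \<in> K"
    using am ap a0 exhaust_3[of i] exhaust_2[of j] by auto
qed

theorem lemma8p5: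
  fixes D :: "'a::field_char_0 \<Rightarrow> 'a"
    and F E C :: "'a set"
    and am ap :: "'a ^ 3" and a0 :: "'a ^ 2"
    and A Y :: "'a ^ 3 ^ 3"
    and r1 r2 c0 c1 c2 :: 'a
    and m :: int
  assumes "derivation D"
    and "diff_subfield D F"
    and "C = constants D F"
    and "algebraically_closed_set C"
    and "A = chevalley_matrix am a0 ap"
    and "A \<in> sl3 F"
    and "picard_vessiot D F E A"
    and "fundamental_matrix D E A Y"
    and "galois_matrix_group D F E Y = SL3 C"
    and "diff_indeterminates D E (\<lambda>i::2. if i = 1 then r1 else r2)"
    and "c2 = - (ap $ 3)"
    and "c1 = ap $ 3 * r1 * r2 - r2 * ap $ 2 - r1 * ap $ 1 + a0 $ 1 + a0 $ 2"
    and "c0 = r2 * am $ 1 + am $ 3 - (r2 * (a0 $ 2 - a0 $ 1) + am $ 2) * r1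
              + (r2 * ap $ 2 - a0 $ 2) * r1 * r2 - r1 * D r2"
    and "m > 0"
  shows "\<not> (\<exists>y :: int \<Rightarrow> 'a.
           (\<forall>k\<in>{0..<m}. y k \<in> diff_field_gen D (E \<union> {r1, r2})) \<and>
           y m = 1 \<and> y (-1) = 0 \<and>
           (\<forall>k\<in>{0..<m}.
              D (y k) = (c2 * y (m - 1) - of_int m * c1 + of_int k * c1) * y k
                        + of_int (k - m - 1) * c2 * y (k - 1)
                        + of_int (k + 1) * c0 * y (k + 1)))"
proof
  assume "\<exists>y :: int \<Rightarrow> 'a.
           (\<forall>k\<in>{0..<m}. y k \<in> diff_field_gen D (E \<union> {r1, r2})) \<and>
           y m = 1 \<and> y (-1) = 0 \<and>
           (\<forall>k\<in>{0..<m}.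
              D (y k) = (c2 * y (m - 1) - of_int m * c1 + of_int k * c1) * y k
                        + of_int (k - m - 1) * c2 * y (k - 1)
                        + of_int (k + 1) * c0 * y (k + 1))"
  then obtain y :: "int \<Rightarrow> 'a" where y:
      "\<And>k. k \<in> {0..<m} \<Longrightarrow> y k \<in> diff_field_gen D (E \<union> {r1, r2})" "y m = 1" "y (-1) = 0"
      "\<And>k. k \<in> {0..<m} \<Longrightarrow>
              D (y k) = (c2 * y (m - 1) - of_int m * c1 + of_int k * c1) * y k
                        + of_int (k - m - 1) * c2 * y (k - 1)
                        + of_int (k + 1) * c0 * y (k + 1)"
    by blast
  have E: "diff_subfield D E" "subfield_set E" "F \<subseteq> E"
    using assms(7) by (auto simp: picard_vessiot_def diff_subfield_def)
  have "matrix_entries (chevalley_matrix am a0 ap) \<subseteq> E"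
    using assms(5,6) E(3) by (auto simp: sl3_def)
  note entries = chevalley_matrix_entries[OF this E(2)]
  let ?L = "subfield_gen (insert r2 E)"
  have base: "a \<in> ?L" if "a \<in> insert r2 E" for a
    using that subfield_gen_superset by blast
  have L: "am $ i \<in> ?L" "a0 $ j \<in> ?L" "ap $ i \<in> ?L" "r2 \<in> ?L" for i j
    by (intro base insertI1 insertI2 entries)+
  note cl = subfield_set_closed[OF subfield_set_subfield_gen]
  show False
  proof (rule riccati_no_darboux_polynomial[where y = y, OF assms(1) E(1) assms(10)])
    show "c2 \<in> ?L" unfolding assms(11) by (intro cl L)
    show "a0 $ 1 + a0 $ 2 - r2 * ap $ 2 \<in> ?L" by (intro cl L)
    show "ap $ 3 * r2 - ap $ 1 \<in> ?L" by (intro cl L)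
    show "r2 * am $ 1 + am $ 3 \<in> ?L" by (intro cl L)
    show "(r2 * ap $ 2 - a0 $ 2) * r2 - (r2 * (a0 $ 2 - a0 $ 1) + am $ 2) \<in> ?L"
      by (intro cl L)
    show "c1 = a0 $ 1 + a0 $ 2 - r2 * ap $ 2 + (ap $ 3 * r2 - ap $ 1) * r1"
      unfolding assms(12) by (simp add: algebra_simps)
    show "c0 = r2 * am $ 1 + am $ 3
        + ((r2 * ap $ 2 - a0 $ 2) * r2 - (r2 * (a0 $ 2 - a0 $ 1) + am $ 2) - D r2) * r1"
      unfolding assms(13) by (simp add: algebra_simps)
  qed (fact \<open>m > 0\<close> y)+
qed

end
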